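(* Let $c\in(0,\infty)$ and assign to the edges of the simple ladder graph the weights $1$ to each $h_{i,n}$ and $c$ to each $z_n$ ($i=0,1$, $n\in\mathbb{Z}$). Let $\alpha:=c+1-\sqrt{c^2+2c}\in(0,1)$. Then for $n\in\{1,2,\dots\}$ the weighted number of spanning trees of $G^L_{0,n-1}$ is $$\sum_{t}\ \prod_{e\in t}\mathrm{weight}(e)=\frac12\,\frac{1-\alpha}{1+\alpha}\,\big(\alpha^{-n}-\alpha^{n}\big),$$ where the sum is over all spanning trees $t$ of $G^L_{0,n-1}$. In particular (case $c=1$), the number of spanning trees of $G^L_{0,n-1}$ is $$\frac{1}{2\sqrt3}\Big((2+\sqrt3)^n-(2-\sqrt3)^n\Big).$$
   Context: The simple ladder graph $G^L$ has vertex set $\{0,1\}\times\mathbb{Z}$ and edges $z_m=\{(0,m),(1,m)\}$ and $h_{i,m}=\{(i,m-1),(i,m)\}$ for $m\in\mathbb{Z}$, $i\in\{0,1\}$. $G^L_{m,n}$ is the subgraph induced by $\{0,1\}\times\{m,\dots,n\}$. *)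

theory Defs
  imports Complex_Main
begin

text \<open>
  Simple undirected graphs: every edge is a two-element set of vertices.
\<close>

record 'v ugraph =
  verts :: "'v set"
  edges :: "'v set set"

definition simple_graph :: "'v ugraph \<Rightarrow> bool" where
  "simple_graph G \<longleftrightarrow> (\<forall>e\<in>edges G. e \<subseteq> verts G \<and> card e = 2)"

definition subgraph :: "'v ugraph \<Rightarrow> 'v ugraph \<Rightarrow> bool" where
  "subgraph H G \<longleftrightarrow> simple_graph H \<and> verts H \<subseteq> verts G \<and> edges H \<subseteq> edges G"

definition induced_subgraph :: "'v ugraph \<Rightarrow> 'v set \<Rightarrow> 'v ugraph" where
  "induced_subgraph G S = \<lparr>verts = verts G \<inter> S, edges = {e \<in> edges G. e \<subseteq> S}\<rparr>"

definition is_walk :: "'v ugraph \<Rightarrow> 'v list \<Rightarrow> bool" where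
  "is_walk G p \<longleftrightarrow>
     p \<noteq> [] \<and> set p \<subseteq> verts G \<and> successively (\<lambda>u v. {u, v} \<in> edges G) p"

definition connected_graph :: "'v ugraph \<Rightarrow> bool" where
  "connected_graph G \<longleftrightarrow> verts G \<noteq> {} \<and>
     (\<forall>u\<in>verts G. \<forall>v\<in>verts G. \<exists>p. is_walk G p \<and> hd p = u \<and> last p = v)"

text \<open>
  A cycle is given by its pairwise distinct vertices in cyclic order; the first vertex
  is not repeated at the end of the list. Demanding at least three vertices excludes
  walking back and forth along one edge.
\<close>

definition is_cycle :: "'v ugraph \<Rightarrow> 'v list \<Rightarrow> bool" where
  "is_cycle G p \<longleftrightarrow>
     3 \<le> length p \<and> distinct p \<and> is_walk G p \<and> {last p, hd p} \<in> edges G"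

definition is_tree :: "'v ugraph \<Rightarrow> bool" where
  "is_tree G \<longleftrightarrow> simple_graph G \<and> connected_graph G \<and> (\<nexists>p. is_cycle G p)"

definition spanning_trees :: "'v ugraph \<Rightarrow> 'v ugraph set" where
  "spanning_trees G = {T. subgraph T G \<and> verts T = verts G \<and> is_tree T}"

definition rung :: "int \<Rightarrow> (nat \<times> int) set" where
  "rung m = {(0, m), (1, m)}"

definition rail :: "nat \<Rightarrow> int \<Rightarrow> (nat \<times> int) set" where
  "rail i m = {(i, m - 1), (i, m)}"

definition ladder :: "(nat \<times> int) ugraph" where
  "ladder = \<lparr>verts = {0, 1} \<times> UNIV,
             edges = range rung \<union> {rail i m | i m. i \<in> {0, 1}}\<rparr>"

definition ladder_segment :: "int \<Rightarrow> int \<Rightarrow> (nat \<times> int) ugraph" where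
  "ladder_segment m n = induced_subgraph ladder ({0, 1} \<times> {m..n})"

end

theory Submission
  imports Defs
begin

text \<open>
  The proof is a two-state transfer matrix. Cut a spanning tree of the first \<open>n + 2\<close> columns of
  the ladder down to the first \<open>n + 1\<close> columns. What remains is acyclic, and it is either again a
  spanning tree, or a spanning forest with two components, one through each end of the last rung:
  any other component would have no way to be connected through the new column. Let \<open>T\<^sub>n\<close> and
  \<open>F\<^sub>n\<close> be the weighted numbers of spanning trees and of such split forests on columns
  \<open>0, \<dots>, n\<close>. Going through the eight subsets of the three new edges (two rails of weight \<open>1\<close>,
  one rung of weight \<open>c\<close>) gives
  \<open>T\<^sub>n\<^sub>+\<^sub>1 = (1 + 2c) T\<^sub>n + c F\<^sub>n\<close> and \<open>F\<^sub>n\<^sub>+\<^sub>1 = 2 T\<^sub>n + F\<^sub>n\<close>,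
  starting from \<open>T\<^sub>0 = c\<close> and \<open>F\<^sub>0 = 1\<close>. The matrix has trace \<open>2 + 2c\<close> and determinant \<open>1\<close>,
  so its eigenvalues are \<open>\<alpha>\<close> and \<open>1 / \<alpha>\<close>, and expanding the initial vector in eigenvectors
  yields the formula (\<open>transfer_solution\<close>). The number of spanning trees is the case in which
  all weights are \<open>1\<close>.

  The case analysis over the new edges (\<open>extend_by_column\<close>) is mechanical once connectivity and
  acyclicity are described by rules for inserting one edge at a time (\<open>reach_insert\<close>,
  \<open>forest_insert\<close>). For this purpose a graph with a fixed vertex set is replaced by its set of
  edges, walks by a reflexive transitive closure, and the absence of cycles by the property that
  every edge is a bridge (\<open>acyclic_iff_forest\<close>).
\<close>

section \<open>Reachability and forests under insertion of an edge\<close>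

definition reach :: "'v set set \<Rightarrow> 'v \<Rightarrow> 'v \<Rightarrow> bool" where
  "reach E = (\<lambda>x y. {x, y} \<in> E)\<^sup>*\<^sup>*"

text \<open>
  A set of edges is a forest if each of its edges is a bridge. Unlike the absence of cycles,
  this form follows the insertion of an edge without any manipulation of paths.
\<close>

definition forest :: "'v set set \<Rightarrow> bool" where
  "forest E \<longleftrightarrow> (\<forall>u v. {u, v} \<in> E \<longrightarrow> \<not> reach (E - {{u, v}}) u v)"

lemma reach_refl [simp]: "reach E x x"
  by (simp add: reach_def)

lemma reach_edge: "{x, y} \<in> E \<Longrightarrow> reach E x y"
  by (auto simp: reach_def)

lemma reach_trans: "reach E x y \<Longrightarrow> reach E y z \<Longrightarrow> reach E x z"
  unfolding reach_def by (rule rtranclp_trans)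

lemma reach_sym: "reach E x y \<Longrightarrow> reach E y x"
  unfolding reach_def
  by (rule sympD[OF symp_rtranclp]) (auto simp: symp_def insert_commute)

lemma reach_commute: "reach E x y \<longleftrightarrow> reach E y x"
  using reach_sym by metis

lemma reach_mono: "reach E x y \<Longrightarrow> E \<subseteq> F \<Longrightarrow> reach F x y"
  unfolding reach_def by (erule rtranclp_mono[THEN predicate2D, rotated]) auto

text \<open>
  A shortest walk uses the new edge at most once, in one of its two directions.
\<close>

lemma reach_insert:
  "reach (insert {u, v} E) x y \<longleftrightarrow>
     reach E x y \<or> reach E x u \<and> reach E v y \<or> reach E x v \<and> reach E u y"
proof
  assume "reach (insert {u, v} E) x y"
  then show "reach E x y \<or> reach E x u \<and> reach E v y \<or> reach E x v \<and> reach E u y"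
    unfolding reach_def[of "insert _ _"]
  proof (induction rule: rtranclp_induct)
    case base
    show ?case by simp
  next
    case (step y z)
    from step.hyps(2) consider "{y, z} \<in> E" | "y = u" "z = v" | "y = v" "z = u"
      by (auto simp: doubleton_eq_iff)
    then show ?case
    proof cases
      case 1
      then show ?thesis using step.IH reach_edge reach_trans by metis
    next
      case 2
      then show ?thesis using step.IH reach_refl reach_trans by metis
    next
      case 3
      then show ?thesis using step.IH reach_refl reach_trans by metis
    qed
  qed
next
  have "E \<subseteq> insert {u, v} E" "reach (insert {u, v} E) u v"
    by (auto intro: reach_edge)
  moreover assume "reach E x y \<or> reach E x u \<and> reach E v y \<or> reach E x v \<and> reach E u y"
  ultimately show "reach (insert {u, v} E) x y"
    by (meson reach_mono reach_sym reach_trans)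
qed

lemma reach_isolated:
  assumes "w \<notin> \<Union> E"
  shows "reach E w x \<longleftrightarrow> x = w" "reach E x w \<longleftrightarrow> x = w"
proof -
  have "reach E w x \<Longrightarrow> x = w"
    unfolding reach_def by (erule converse_rtranclpE) (use assms in auto)
  then show "reach E w x \<longleftrightarrow> x = w" by auto
  then show "reach E x w \<longleftrightarrow> x = w" using reach_commute by metis
qed

text \<open>
  A new edge closes a cycle exactly when its ends were already connected. If it does not, an old
  edge \<open>{x, y}\<close> stays a bridge: a detour from \<open>x\<close> to \<open>y\<close> through the new edge would, together with
  \<open>{x, y}\<close> itself, connect \<open>u\<close> with \<open>v\<close> inside the old edges.
\<close>

lemma forest_insert:
  assumes "{u, v} \<notin> E"
  shows "forest (insert {u, v} E) \<longleftrightarrow> forest E \<and> \<not> reach E u v"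
proof
  assume *: "forest (insert {u, v} E)"
  have "forest E"
    unfolding forest_def
  proof (intro allI impI)
    fix x y assume "{x, y} \<in> E"
    then have "\<not> reach (insert {u, v} E - {{x, y}}) x y"
      using * by (auto simp: forest_def)
    then show "\<not> reach (E - {{x, y}}) x y"
      using reach_mono[of "E - {{x, y}}" x y "insert {u, v} E - {{x, y}}"] by auto
  qed
  moreover have "\<not> reach E u v"
    using * assms by (force simp: forest_def)
  ultimately show "forest E \<and> \<not> reach E u v" by simp
next
  assume *: "forest E \<and> \<not> reach E u v"
  show "forest (insert {u, v} E)"
    unfolding forest_def
  proof (intro allI impI notI)
    fix x y
    assume xy: "{x, y} \<in> insert {u, v} E" and r: "reach (insert {u, v} E - {{x, y}}) x y"
    show False
    proof (cases "{x, y} = {u, v}")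
      case True
      then have "reach E x y" using r assms by simp
      then show False using True * reach_sym by (metis doubleton_eq_iff)
    next
      case False
      then have e: "{x, y} \<in> E" using xy by simp
      have "reach (insert {u, v} (E - {{x, y}})) x y"
        using r False by (simp add: insert_Diff_if)
      then consider "reach (E - {{x, y}}) x y"
        | "reach (E - {{x, y}}) x u" "reach (E - {{x, y}}) v y"
        | "reach (E - {{x, y}}) x v" "reach (E - {{x, y}}) u y"
        unfolding reach_insert by blast
      then show False
      proof cases
        case 1
        then show False using * e by (auto simp: forest_def)
      next
        case 2
        then have "reach E x u" "reach E v y" by (auto elim: reach_mono)
        then show False using * reach_edge[OF e] reach_sym reach_trans by metis
      next
        case 3
        then have "reach E x v" "reach E u y" by (auto elim: reach_mono)
        then show False using * reach_edge[OF e] reach_sym reach_trans by metis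
      qed
    qed
  qed
qed

section \<open>Walks and cycles of a graph in terms of its edge set\<close>

lemma reach_if_successively:
  "p \<noteq> [] \<Longrightarrow> successively (\<lambda>u v. {u, v} \<in> E) p \<Longrightarrow> reach E (hd p) (last p)"
proof (induction p rule: induct_list012)
  case (3 x y zs)
  then show ?case using reach_edge reach_trans by fastforce
qed auto

lemma distinct_path_if_reach:
  assumes "reach E u v"
  shows "\<exists>p. p \<noteq> [] \<and> distinct p \<and> hd p = u \<and> last p = v \<and>
    successively (\<lambda>u v. {u, v} \<in> E) p"
  using assms unfolding reach_def
proof (induction rule: rtranclp_induct)
  case base
  show ?case by (rule exI[of _ "[u]"]) simp
next
  case (step y z)
  then obtain p where p: "p \<noteq> []" "distinct p" "hd p = u" "last p = y"
    "successively (\<lambda>u v. {u, v} \<in> E) p" by blast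
  show ?case
  proof (cases "z \<in> set p")
    case True
    (* The path already met the new endpoint, so it is cut at that point. *)
    then obtain q r where "p = q @ z # r" by (meson split_list)
    then show ?thesis using p
      by (intro exI[of _ "q @ [z]"]) (auto simp: successively_append_iff hd_append)
  next
    case False
    then show ?thesis using p step.hyps
      by (intro exI[of _ "p @ [z]"]) (auto simp: successively_append_iff)
  qed
qed

lemma successively_vertices:
  assumes "\<Union> E \<subseteq> V" "p \<noteq> []" "hd p \<in> V" "successively (\<lambda>u v. {u, v} \<in> E) p"
  shows "set p \<subseteq> V"
  using assms(2-)
proof (induction p rule: induct_list012)
  case (3 x y zs)
  then show ?case using assms(1) by auto
qed auto

lemma walk_iff_reach:
  assumes "simple_graph G" "u \<in> verts G"
  shows "(\<exists>p. is_walk G p \<and> hd p = u \<and> last p = v) \<longleftrightarrow> reach (edges G) u v"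
proof
  assume "reach (edges G) u v"
  then obtain p where p: "p \<noteq> []" "hd p = u" "last p = v"
    "successively (\<lambda>u v. {u, v} \<in> edges G) p"
    using distinct_path_if_reach by metis
  moreover have "\<Union> (edges G) \<subseteq> verts G"
    using assms by (auto simp: simple_graph_def)
  ultimately show "\<exists>p. is_walk G p \<and> hd p = u \<and> last p = v"
    using successively_vertices[of "edges G" "verts G" p] assms(2)
    by (auto simp: is_walk_def)
qed (auto simp: is_walk_def dest: reach_if_successively)

text \<open>
  On a list of distinct vertices, two consecutive ones can be the first and the last only if there
  are no others. This is where the length bound in the definition of a cycle is needed.
\<close>

lemma successively_avoids_closing_edge:
  assumes "distinct p" "3 \<le> length p" "successively (\<lambda>u v. {u, v} \<in> E) p"
  shows "successively (\<lambda>u v. {u, v} \<in> E - {{last p, hd p}}) p"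
  unfolding successively_conv_nth
proof (intro allI impI)
  fix i assume i: "Suc i < length p"
  have "{p ! i, p ! Suc i} \<noteq> {last p, hd p}"
  proof
    assume "{p ! i, p ! Suc i} = {last p, hd p}"
    moreover have "p \<noteq> []" using assms(2) by auto
    ultimately have "{p ! i, p ! Suc i} = {p ! (length p - 1), p ! 0}"
      by (simp add: last_conv_nth hd_conv_nth)
    then have "p ! i = p ! 0" "p ! Suc i = p ! (length p - 1)"
      using i assms(1) by (auto simp: doubleton_eq_iff nth_eq_iff_index_eq)
    moreover have "0 < length p" "length p - 1 < length p" "i < length p"
      using i by auto
    ultimately have "i = 0" "Suc i = length p - 1"
      using i nth_eq_iff_index_eq[OF assms(1)] by blast+
    then show False using assms(2) by simp
  qed
  then show "{p ! i, p ! Suc i} \<in> E - {{last p, hd p}}"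
    using i assms(3) by (auto simp: successively_conv_nth)
qed

text \<open>
  If an edge is not a bridge, then a simple path avoiding it but joining its ends closes up with it
  to a cycle. Conversely, the closing edge of a cycle is bypassed by the rest of the cycle.
\<close>

lemma acyclic_iff_forest:
  assumes "simple_graph G"
  shows "(\<nexists>p. is_cycle G p) \<longleftrightarrow> forest (edges G)"
proof -
  have "\<exists>p. is_cycle G p" if ncyc: "\<not> forest (edges G)"
  proof -
    obtain u v where uv: "{u, v} \<in> edges G" "reach (edges G - {{u, v}}) u v"
      using ncyc by (auto simp: forest_def)
    obtain p where p: "p \<noteq> []" "distinct p" "hd p = u" "last p = v"
      "successively (\<lambda>x y. {x, y} \<in> edges G - {{u, v}}) p"
      using distinct_path_if_reach[OF uv(2)] by blast
    have G: "\<Union> (edges G) \<subseteq> verts G" "card {u, v} = 2"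
      using assms uv(1) by (auto simp: simple_graph_def)
    then have "u \<noteq> v" by auto
    (* A path with at most two vertices is a single vertex or the removed edge. *)
    then have "p \<noteq> [x]" "p \<noteq> [x, y]" for x y
      using p by auto
    then have "3 \<le> length p"
      using p(1) by (cases p rule: remdups_adj.cases; cases "tl (tl p)") auto
    moreover have "successively (\<lambda>x y. {x, y} \<in> edges G) p"
      using p(5) by (rule successively_mono) auto
    moreover have "set p \<subseteq> verts G"
      using successively_vertices[OF G(1) p(1)] calculation(2) uv(1) G(1) p(3) by auto
    ultimately show ?thesis
      using p uv(1) by (auto simp: is_cycle_def is_walk_def insert_commute)
  qed
  moreover have "\<not> forest (edges G)" if "is_cycle G p" for p
  proof -
    from that have p: "3 \<le> length p" "distinct p" "{last p, hd p} \<in> edges G"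
      "successively (\<lambda>u v. {u, v} \<in> edges G) p"
      by (auto simp: is_cycle_def is_walk_def)
    then have "reach (edges G - {{last p, hd p}}) (hd p) (last p)"
      by (intro reach_if_successively successively_avoids_closing_edge) auto
    then show ?thesis
      using p(3) reach_sym unfolding forest_def by metis
  qed
  ultimately show ?thesis by blast
qed

section \<open>Extending a graph by one column of the ladder\<close>

definition tree_on :: "'v set \<Rightarrow> 'v set set \<Rightarrow> bool" where
  "tree_on V E \<longleftrightarrow> forest E \<and> (\<forall>x\<in>V. \<forall>y\<in>V. reach E x y)"

text \<open>
  The second state of the transfer matrix: a spanning forest with exactly two components, which
  separates \<open>a\<close> from \<open>b\<close>. Adding an edge \<open>{a, b}\<close> would turn it into a spanning tree.
\<close>

definition split_forest_on :: "'v set \<Rightarrow> 'v \<Rightarrow> 'v \<Rightarrow> 'v set set \<Rightarrow> bool" where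
  "split_forest_on V a b E \<longleftrightarrow>
     forest E \<and> \<not> reach E a b \<and> (\<forall>x\<in>V. reach E a x \<or> reach E b x)"

text \<open>
  Connectedness is checked from a single root, which leaves one quantifier over the vertices
  instead of two.
\<close>

lemma tree_on_root:
  assumes "r \<in> V"
  shows "tree_on V E \<longleftrightarrow> forest E \<and> (\<forall>x\<in>V. reach E r x)"
  using assms reach_sym reach_trans unfolding tree_on_def by metis

text \<open>
  All entries of the transfer matrix. The vertices \<open>a\<close>, \<open>b\<close> are the ends of the last column, and
  \<open>a'\<close>, \<open>b'\<close> those of the new one. A tree on the larger graph needs a connection between \<open>a'\<close>
  and \<open>b'\<close> and a rail back to the old columns. With two of the three new edges, \<open>a'\<close> and \<open>b'\<close>
  are leaves or a pendant path, so removing them leaves a tree; with all three the path \<open>a, a', b', b\<close> joins the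
  two halves of a split forest. A split forest on the larger graph either leaves one of the new
  vertices isolated, next to an old tree, or prolongs both halves of an old split forest. Each
  equivalence is obtained by evaluating the insertion rules, because \<open>a'\<close> and \<open>b'\<close> are isolated in
  \<open>E\<close>.
\<close>

lemma extend_by_column:
  assumes E: "\<Union> E \<subseteq> V" and V: "a \<in> V" "b \<in> V" "a' \<notin> V" "b' \<notin> V" "a \<noteq> b" "a' \<noteq> b'"
  defines "W \<equiv> insert a' (insert b' V)"
  shows
    "tree_on W E \<longleftrightarrow> False"
    "tree_on W (insert {a, a'} E) \<longleftrightarrow> False"
    "tree_on W (insert {b, b'} E) \<longleftrightarrow> False"
    "tree_on W (insert {a', b'} E) \<longleftrightarrow> False"
    "tree_on W (insert {a, a'} (insert {b, b'} E)) \<longleftrightarrow> tree_on V E"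
    "tree_on W (insert {a, a'} (insert {a', b'} E)) \<longleftrightarrow> tree_on V E"
    "tree_on W (insert {b, b'} (insert {a', b'} E)) \<longleftrightarrow> tree_on V E"
    "tree_on W (insert {a, a'} (insert {b, b'} (insert {a', b'} E))) \<longleftrightarrow> split_forest_on V a b E"
    "split_forest_on W a' b' E \<longleftrightarrow> False"
    "split_forest_on W a' b' (insert {a, a'} E) \<longleftrightarrow> tree_on V E"
    "split_forest_on W a' b' (insert {b, b'} E) \<longleftrightarrow> tree_on V E"
    "split_forest_on W a' b' (insert {a', b'} E) \<longleftrightarrow> False"
    "split_forest_on W a' b' (insert {a, a'} (insert {b, b'} E)) \<longleftrightarrow> split_forest_on V a b E"
    "split_forest_on W a' b' (insert {a, a'} (insert {a', b'} E)) \<longleftrightarrow> False"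
    "split_forest_on W a' b' (insert {b, b'} (insert {a', b'} E)) \<longleftrightarrow> False"
    "split_forest_on W a' b' (insert {a, a'} (insert {b, b'} (insert {a', b'} E))) \<longleftrightarrow> False"
proof -
  have new: "{a, a'} \<notin> E" "{b, b'} \<notin> E" "{a', b'} \<notin> E" and iso: "a' \<notin> \<Union> E" "b' \<notin> \<Union> E"
    using E V by auto
  have ne: "a \<noteq> a'" "a \<noteq> b'" "b \<noteq> a'" "b \<noteq> b'" using V by auto
  have old: "x = a' \<longleftrightarrow> False" "x = b' \<longleftrightarrow> False" if "x \<in> V" for x
    using that V by auto
  have inhabited: "\<exists>x. x \<in> V" using V by auto
  have root: "a' \<in> insert a' (insert b' V)" by simp
  have comm: "reach E b a \<longleftrightarrow> reach E a b" by (rule reach_commute)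
  note simps = tree_on_root[OF root] split_forest_on_def W_def forest_insert reach_insert new
    reach_isolated[OF iso(1)] reach_isolated[OF iso(2)] doubleton_eq_iff comm old inhabited
  (* A tree on V is rooted at the old end of a rail that is present: b here, a in the other cases. *)
  show
    "tree_on W (insert {b, b'} (insert {a', b'} E)) \<longleftrightarrow> tree_on V E"
    "split_forest_on W a' b' (insert {b, b'} E) \<longleftrightarrow> tree_on V E"
    using V ne by (simp (no_asm_simp) add: simps tree_on_root[OF V(2)]
        cong: ball_cong bex_cong conj_cong; (use V in blast)?)+
  show
    "tree_on W E \<longleftrightarrow> False"
    "tree_on W (insert {a, a'} E) \<longleftrightarrow> False"
    "tree_on W (insert {b, b'} E) \<longleftrightarrow> False"
    "tree_on W (insert {a', b'} E) \<longleftrightarrow> False"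
    "tree_on W (insert {a, a'} (insert {b, b'} E)) \<longleftrightarrow> tree_on V E"
    "tree_on W (insert {a, a'} (insert {a', b'} E)) \<longleftrightarrow> tree_on V E"
    "tree_on W (insert {a, a'} (insert {b, b'} (insert {a', b'} E))) \<longleftrightarrow> split_forest_on V a b E"
    "split_forest_on W a' b' E \<longleftrightarrow> False"
    "split_forest_on W a' b' (insert {a, a'} E) \<longleftrightarrow> tree_on V E"
    "split_forest_on W a' b' (insert {a', b'} E) \<longleftrightarrow> False"
    "split_forest_on W a' b' (insert {a, a'} (insert {b, b'} E)) \<longleftrightarrow> split_forest_on V a b E"
    "split_forest_on W a' b' (insert {a, a'} (insert {a', b'} E)) \<longleftrightarrow> False"
    "split_forest_on W a' b' (insert {b, b'} (insert {a', b'} E)) \<longleftrightarrow> False"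
    "split_forest_on W a' b' (insert {a, a'} (insert {b, b'} (insert {a', b'} E))) \<longleftrightarrow> False"
    using V ne by (simp (no_asm_simp) add: simps tree_on_root[OF V(1)]
        cong: ball_cong bex_cong conj_cong; (use V in blast)?)+
qed

section \<open>Weighted counting of edge sets\<close>

definition weighted_count :: "('e \<Rightarrow> real) \<Rightarrow> 'e set \<Rightarrow> ('e set \<Rightarrow> bool) \<Rightarrow> real" where
  "weighted_count w A P = (\<Sum>E | E \<subseteq> A \<and> P E. \<Prod>e\<in>E. w e)"

text \<open>
  Edge sets are split according to whether they contain \<open>x\<close>.
\<close>

lemma weighted_count_insert:
  assumes "finite A" "x \<notin> A"
  shows "weighted_count w (insert x A) P =
    weighted_count w A P + w x * weighted_count w A (\<lambda>E. P (insert x E))"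
proof -
  let ?B = "{E. E \<subseteq> A \<and> P E}" and ?C = "{E. E \<subseteq> A \<and> P (insert x E)}"
  have fin: "finite ?B" "finite ?C"
    using assms(1) by (auto intro: finite_subset[of _ "Pow A"])
  have inj: "inj_on (insert x) ?C"
    using assms(2) by (auto simp: inj_on_def)
  have "{E. E \<subseteq> insert x A \<and> P E} = ?B \<union> insert x ` ?C"
  proof (intro equalityI subsetI)
    fix E assume E: "E \<in> {E. E \<subseteq> insert x A \<and> P E}"
    show "E \<in> ?B \<union> insert x ` ?C"
    proof (cases "x \<in> E")
      case True
      then have "E = insert x (E - {x})" by auto
      then show ?thesis using E by (intro UnI2 image_eqI[of _ _ "E - {x}"]) auto
    qed (use E in auto)
  qed auto
  then have "weighted_count w (insert x A) P =
      weighted_count w A P + (\<Sum>E\<in>insert x ` ?C. \<Prod>e\<in>E. w e)"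
    unfolding weighted_count_def using fin assms(2)
    by (simp only:) (intro sum.union_disjoint, auto)
  also have "(\<Sum>E\<in>insert x ` ?C. \<Prod>e\<in>E. w e) = (\<Sum>E\<in>?C. w x * (\<Prod>e\<in>E. w e))"
    unfolding sum.reindex[OF inj] comp_def
  proof (rule sum.cong[OF refl])
    fix E assume "E \<in> ?C"
    then have "finite E" "x \<notin> E" using assms finite_subset by auto
    then show "prod w (insert x E) = w x * prod w E" by simp
  qed
  finally show ?thesis by (simp add: weighted_count_def sum_distrib_left)
qed

lemma weighted_count_cong:
  "(\<And>E. E \<subseteq> A \<Longrightarrow> P E \<longleftrightarrow> Q E) \<Longrightarrow> weighted_count w A P = weighted_count w A Q"
  unfolding weighted_count_def by (rule sum.cong) auto

lemma weighted_count_False [simp]: "weighted_count w A (\<lambda>E. False) = 0"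
  by (simp add: weighted_count_def)

section \<open>The ladder segments\<close>

abbreviation columns :: "nat \<Rightarrow> (nat \<times> int) set" where
  "columns n \<equiv> {0, 1} \<times> {0..int n}"

abbreviation segment_edges :: "nat \<Rightarrow> (nat \<times> int) set set" where
  "segment_edges n \<equiv> edges (ladder_segment 0 (int n))"

lemma verts_segment: "verts (ladder_segment 0 (int n)) = columns n"
  by (auto simp: ladder_segment_def induced_subgraph_def ladder_def)

lemma segment_edges_eq:
  "segment_edges n = rung ` {0..int n} \<union> (rail 0 ` {1..int n} \<union> rail 1 ` {1..int n})"
proof -
  have inside: "rung m \<subseteq> columns n \<longleftrightarrow> m \<in> {0..int n}"
    "rail 0 m \<subseteq> columns n \<longleftrightarrow> m \<in> {1..int n}"
    "rail 1 m \<subseteq> columns n \<longleftrightarrow> m \<in> {1..int n}" for m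
    by (auto simp: rung_def rail_def)
  have "segment_edges n =
      {e \<in> range rung \<union> (range (rail 0) \<union> range (rail 1)). e \<subseteq> columns n}"
    unfolding ladder_segment_def induced_subgraph_def ladder_def by auto
  also have "\<dots> = rung ` {m. rung m \<subseteq> columns n} \<union>
      (rail 0 ` {m. rail 0 m \<subseteq> columns n} \<union> rail 1 ` {m. rail 1 m \<subseteq> columns n})"
    by blast
  finally show ?thesis unfolding inside Collect_mem_eq .
qed

lemma segment_edges_Suc:
  "segment_edges (Suc n) = insert (rail 0 (int n + 1)) (insert (rail 1 (int n + 1))
     (insert (rung (int n + 1)) (segment_edges n)))"
proof -
  have "{0..int (Suc n)} = insert (int n + 1) {0..int n}"
    "{1..int (Suc n)} = insert (int n + 1) {1..int n}" by auto
  then show ?thesis unfolding segment_edges_eq by (simp only: image_insert) blast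
qed

lemma columns_Suc:
  "columns (Suc n) = insert (0, int n + 1) (insert (1, int n + 1) (columns n))"
  by auto

lemma Union_segment_edges: "\<Union> (segment_edges n) \<subseteq> columns n"
  by (auto simp: ladder_segment_def induced_subgraph_def)

lemma simple_segment: "simple_graph (ladder_segment 0 (int n))"
  unfolding simple_graph_def verts_segment segment_edges_eq
  by (auto simp: rung_def rail_def)

lemma finite_segment_edges: "finite (segment_edges n)"
  by (simp add: segment_edges_eq)

definition tree_weight :: "((nat \<times> int) set \<Rightarrow> real) \<Rightarrow> nat \<Rightarrow> real" where
  "tree_weight w n = weighted_count w (segment_edges n) (tree_on (columns n))"

definition split_weight :: "((nat \<times> int) set \<Rightarrow> real) \<Rightarrow> nat \<Rightarrow> real" where
  "split_weight w n = weighted_count w (segment_edges n)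
     (split_forest_on (columns n) (0, int n) (1, int n))"

lemma is_tree_iff_tree_on:
  assumes "simple_graph G" "verts G \<noteq> {}"
  shows "is_tree G \<longleftrightarrow> tree_on (verts G) (edges G)"
  unfolding is_tree_def tree_on_def connected_graph_def acyclic_iff_forest[OF assms(1)]
  using assms walk_iff_reach[OF assms(1)] by auto

text \<open>
  A spanning tree is determined by its edges, since its vertices are those of the segment.
\<close>

lemma sum_spanning_trees:
  "(\<Sum>T\<in>spanning_trees (ladder_segment 0 (int n)). \<Prod>e\<in>edges T. w e) = tree_weight w n"
proof -
  let ?G = "ladder_segment 0 (int n)"
  have simple: "simple_graph \<lparr>verts = columns n, edges = E\<rparr>" if "E \<subseteq> segment_edges n" for E
    using that simple_segment[of n] unfolding simple_graph_def verts_segment by auto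
  have tree: "is_tree \<lparr>verts = columns n, edges = E\<rparr> \<longleftrightarrow> tree_on (columns n) E"
    if "E \<subseteq> segment_edges n" for E
    using is_tree_iff_tree_on[OF simple[OF that]] by simp
  have "bij_betw edges (spanning_trees ?G)
      {E. E \<subseteq> segment_edges n \<and> tree_on (columns n) E}"
  proof (rule bij_betw_byWitness[where f' = "\<lambda>E. \<lparr>verts = columns n, edges = E\<rparr>"])
    have "edges T \<subseteq> segment_edges n \<and> tree_on (columns n) (edges T)"
      if "T \<in> spanning_trees ?G" for T
    proof -
      have T: "edges T \<subseteq> segment_edges n" "verts T = columns n" "is_tree T"
        using that by (auto simp: spanning_trees_def subgraph_def verts_segment)
      then have "T = \<lparr>verts = columns n, edges = edges T\<rparr>" by (cases T) simp
      then show ?thesis using T tree[of "edges T"] by metis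
    qed
    then show "edges ` spanning_trees ?G \<subseteq> {E. E \<subseteq> segment_edges n \<and> tree_on (columns n) E}"
      by blast
    show "(\<lambda>E. \<lparr>verts = columns n, edges = E\<rparr>) `
        {E. E \<subseteq> segment_edges n \<and> tree_on (columns n) E} \<subseteq> spanning_trees ?G"
      using simple tree by (auto simp: spanning_trees_def subgraph_def verts_segment)
    show "\<forall>T\<in>spanning_trees ?G. \<lparr>verts = columns n, edges = edges T\<rparr> = T"
      by (simp add: spanning_trees_def verts_segment)
  qed simp
  then show ?thesis
    unfolding tree_weight_def weighted_count_def by (rule sum.reindex_bij_betw)
qed

section \<open>The recursion and its solution\<close>

lemma transfer_initial:
  assumes "w (rung 0) = c"
  shows "tree_weight w 0 = c" "split_weight w 0 = 1"
proof -
  have S: "segment_edges 0 = insert (rung 0) {}"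
    unfolding segment_edges_eq by simp
  have V: "columns 0 = {(0, 0), (1, 0)}" by auto
  have empty: "reach {} x y \<longleftrightarrow> x = y" for x y :: "nat \<times> int"
    using reach_isolated[of x "{}"] by auto
  have "forest ({} :: (nat \<times> int) set set)" by (simp add: forest_def)
  then have "tree_on (columns 0) {} \<longleftrightarrow> False" "tree_on (columns 0) {rung 0}"
    "split_forest_on (columns 0) (0, 0) (1, 0) {}"
    "split_forest_on (columns 0) (0, 0) (1, 0) {rung 0} \<longleftrightarrow> False"
    unfolding V by (simp_all add: tree_on_def split_forest_on_def rung_def forest_insert
        reach_insert empty)
  moreover have "weighted_count w {} P = (if P {} then 1 else 0)" for P
    by (auto simp: weighted_count_def Collect_conv_if)
  ultimately show "tree_weight w 0 = c" "split_weight w 0 = 1"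
    unfolding tree_weight_def split_weight_def S
    by (simp_all add: weighted_count_insert assms)
qed

text \<open>
  The number \<open>\<alpha>\<close> is the smaller root of \<open>x\<^sup>2 - (2c + 2) x + 1\<close>, the characteristic polynomial of
  the transfer matrix.
\<close>

lemma alpha_properties:
  fixes c \<alpha> :: real
  assumes "c > 0" and \<alpha>: "\<alpha> = c + 1 - sqrt (c\<^sup>2 + 2 * c)"
  shows "0 < \<alpha>" "\<alpha> < 1" "2 * c * \<alpha> = (1 - \<alpha>)\<^sup>2"
proof -
  have "sqrt (c\<^sup>2 + 2 * c) < sqrt ((c + 1)\<^sup>2)"
    by (intro real_sqrt_less_mono) (simp add: power2_eq_square algebra_simps)
  then show "0 < \<alpha>" using assms by simp
  have "sqrt (c\<^sup>2) < sqrt (c\<^sup>2 + 2 * c)"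
    using assms by (intro real_sqrt_less_mono) simp
  then show "\<alpha> < 1" using assms by simp
  have "(sqrt (c\<^sup>2 + 2 * c))\<^sup>2 = c\<^sup>2 + 2 * c" using assms by simp
  moreover have "sqrt (c\<^sup>2 + 2 * c) = c + 1 - \<alpha>" using \<alpha> by simp
  ultimately have "(c + 1 - \<alpha>)\<^sup>2 = c\<^sup>2 + 2 * c" by simp
  then show "2 * c * \<alpha> = (1 - \<alpha>)\<^sup>2" by (simp add: power2_eq_square algebra_simps)
qed

text \<open>
  The assumption on \<open>\<alpha>\<close> says that \<open>\<alpha> + 1 / \<alpha> = 2 + 2c\<close>, that is, \<open>\<alpha>\<close> and \<open>1 / \<alpha>\<close> are the
  eigenvalues of the transfer matrix. An eigenvector \<open>(t, f)\<close> for \<open>\<lambda>\<close> satisfies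
  \<open>f = 2t / (\<lambda> - 1)\<close>, which produces the companion formula for \<open>F\<close> that the induction needs.
\<close>

lemma transfer_solution:
  fixes T F :: "nat \<Rightarrow> real"
  assumes \<alpha>: "0 < \<alpha>" "2 * c * \<alpha> = (1 - \<alpha>)\<^sup>2"
    and init: "T 0 = c" "F 0 = 1"
    and step: "\<And>n. T (Suc n) = (1 + 2 * c) * T n + c * F n" "\<And>n. F (Suc n) = 2 * T n + F n"
  shows "T n = 1 / 2 * ((1 - \<alpha>) / (1 + \<alpha>)) * ((1 / \<alpha>) ^ Suc n - \<alpha> ^ Suc n)
    \<and> F n = ((1 / \<alpha>) ^ n + \<alpha> ^ Suc n) / (1 + \<alpha>)"
proof -
  have c: "c = (1 - \<alpha>)\<^sup>2 / (2 * \<alpha>)" and nz: "\<alpha> \<noteq> 0" "1 + \<alpha> \<noteq> 0" using \<alpha> by (auto simp: field_simps)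
  show ?thesis
  proof (induction n)
    case 0
    show ?case using nz unfolding init c by (simp add: divide_simps) algebra
  next
    case (Suc n)
    define X Y where "X = (1 / \<alpha>) ^ n" and "Y = \<alpha> ^ n"
    have T: "T n = 1 / 2 * ((1 - \<alpha>) / (1 + \<alpha>)) * (X / \<alpha> - \<alpha> * Y)"
      and F: "F n = (X + \<alpha> * Y) / (1 + \<alpha>)"
      using Suc by (simp_all add: X_def Y_def)
    have pow: "(1 / \<alpha>) ^ Suc n = X / \<alpha>" "(1 / \<alpha>) ^ Suc (Suc n) = X / \<alpha> / \<alpha>"
      "\<alpha> ^ Suc (Suc n) = \<alpha> * \<alpha> * Y"
      by (simp_all add: X_def Y_def)
    have "(1 + 2 * c) * (1 / 2 * ((1 - \<alpha>) / (1 + \<alpha>)) * (X / \<alpha> - \<alpha> * Y)) +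
        c * ((X + \<alpha> * Y) / (1 + \<alpha>)) =
        1 / 2 * ((1 - \<alpha>) / (1 + \<alpha>)) * (X / \<alpha> / \<alpha> - \<alpha> * \<alpha> * Y)"
      using nz unfolding c by (simp add: divide_simps) algebra
    moreover have "2 * (1 / 2 * ((1 - \<alpha>) / (1 + \<alpha>)) * (X / \<alpha> - \<alpha> * Y)) + (X + \<alpha> * Y) / (1 + \<alpha>) =
        (X / \<alpha> + \<alpha> * \<alpha> * Y) / (1 + \<alpha>)"
      using nz by (simp add: divide_simps) algebra
    ultimately show ?case
      unfolding step T F pow by blast
  qed
qed

text \<open>
  The eight terms of the expansion are the subsets of the new edges; \<open>extend_by_column\<close> identifies
  each of them with a tree count, a split forest count, or zero.
\<close>

lemma transfer_Suc:
  assumes rail: "\<forall>i\<in>{0, 1}. \<forall>m. w (rail i m) = 1" and rung: "\<forall>m. w (rung m) = c"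
  shows "tree_weight w (Suc n) = (1 + 2 * c) * tree_weight w n + c * split_weight w n"
    and "split_weight w (Suc n) = 2 * tree_weight w n + split_weight w n"
proof -
  let ?S = "segment_edges n" and ?V = "columns n"
  let ?a = "(0 :: nat, int n)" and ?b = "(1 :: nat, int n)"
  let ?a' = "(0 :: nat, int n + 1)" and ?b' = "(1 :: nat, int n + 1)"
  let ?h = "rail 0 (int n + 1)" and ?k = "rail 1 (int n + 1)" and ?z = "rung (int n + 1)"
  have new: "?h = {?a, ?a'}" "?k = {?b, ?b'}" "?z = {?a', ?b'}"
    by (simp_all add: rail_def rung_def)
  have notin: "?z \<notin> ?S" "?k \<notin> insert ?z ?S" "?h \<notin> insert ?k (insert ?z ?S)"
    using Union_segment_edges[of n] unfolding new by (auto simp: doubleton_eq_iff)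
  have weights: "w ?h = 1" "w ?k = 1" "w ?z = c"
    using rail rung by auto
  have expand: "weighted_count w (segment_edges (Suc n)) P =
      weighted_count w ?S P + weighted_count w ?S (\<lambda>E. P (insert ?h E))
      + weighted_count w ?S (\<lambda>E. P (insert ?k E))
      + c * weighted_count w ?S (\<lambda>E. P (insert ?z E))
      + weighted_count w ?S (\<lambda>E. P (insert ?h (insert ?k E)))
      + c * weighted_count w ?S (\<lambda>E. P (insert ?h (insert ?z E)))
      + c * weighted_count w ?S (\<lambda>E. P (insert ?k (insert ?z E)))
      + c * weighted_count w ?S (\<lambda>E. P (insert ?h (insert ?k (insert ?z E))))" for P
  proof -
    have fin: "finite (insert ?k (insert ?z ?S))" "finite (insert ?z ?S)" "finite ?S"
      using finite_segment_edges[of n] by simp_all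
    show ?thesis
      unfolding segment_edges_Suc weighted_count_insert[OF fin(1) notin(3)]
        weighted_count_insert[OF fin(2) notin(2)] weighted_count_insert[OF fin(3) notin(1)] weights
      by (simp add: algebra_simps)
  qed
  have within: "E \<subseteq> ?S \<Longrightarrow> \<Union> E \<subseteq> ?V" for E
    using Union_segment_edges[of n] by blast
  have mem: "?a \<in> ?V" "?b \<in> ?V" "?a' \<notin> ?V" "?b' \<notin> ?V" "?a \<noteq> ?b" "?a' \<noteq> ?b'"
    by auto
  note ext = extend_by_column[OF within mem]
  have last: "int (Suc n) = int n + 1" by simp
  show "tree_weight w (Suc n) = (1 + 2 * c) * tree_weight w n + c * split_weight w n"
    unfolding tree_weight_def split_weight_def expand columns_Suc new
    by (simp only: ext weighted_count_False cong: weighted_count_cong) (simp add: algebra_simps)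
  show "split_weight w (Suc n) = 2 * tree_weight w n + split_weight w n"
    unfolding tree_weight_def split_weight_def expand columns_Suc new unfolding last
    by (simp only: ext weighted_count_False cong: weighted_count_cong)
qed

theorem proposition1p5:
  fixes n :: nat
  assumes "n \<ge> 1"
  shows
    "(\<forall>(c::real) (\<alpha>::real) (weight :: (nat \<times> int) set \<Rightarrow> real).
        c > 0 \<longrightarrow>
        (\<forall>i\<in>{0, 1}. \<forall>m. weight (rail i m) = 1) \<longrightarrow>
        (\<forall>m. weight (rung m) = c) \<longrightarrow>
        \<alpha> = c + 1 - sqrt (c ^ 2 + 2 * c) \<longrightarrow>
          0 < \<alpha> \<and> \<alpha> < 1 \<and>
          (\<Sum>T\<in>spanning_trees (ladder_segment 0 (int n - 1)). \<Prod>e\<in>edges T. weight e)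
            = 1 / 2 * ((1 - \<alpha>) / (1 + \<alpha>)) * (\<alpha> powi (- int n) - \<alpha> ^ n)) \<and>
     real (card (spanning_trees (ladder_segment 0 (int n - 1))))
       = 1 / (2 * sqrt 3) * ((2 + sqrt 3) ^ n - (2 - sqrt 3) ^ n)"
proof -
  obtain k where n: "n = Suc k" using assms by (cases n) auto
  then have seg: "int n - 1 = int k" by simp
  have solved: "tree_weight w k = 1 / 2 * ((1 - \<alpha>) / (1 + \<alpha>)) * ((1 / \<alpha>) ^ n - \<alpha> ^ n)"
    if "c > 0" "\<forall>i\<in>{0, 1}. \<forall>m. w (rail i m) = 1" "\<forall>m. w (rung m) = c"
      "\<alpha> = c + 1 - sqrt (c ^ 2 + 2 * c)" for w c \<alpha>
  proof -
    have init: "tree_weight w 0 = c" "split_weight w 0 = 1"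
      using that(3) by (simp_all add: transfer_initial)
    show ?thesis
      using transfer_solution[OF alpha_properties(1,3)[OF that(1,4)] init transfer_Suc[OF that(2,3)]]
      unfolding n by blast
  qed
  have inverse: "\<alpha> powi (- int n) = (1 / \<alpha>) ^ n" for \<alpha> :: real
    by (simp add: power_int_minus power_one_over inverse_eq_divide)
  (* For c = 1 the number \<alpha> is 2 - sqrt 3, whose inverse is 2 + sqrt 3. *)
  have "real (card (spanning_trees (ladder_segment 0 (int k)))) = tree_weight (\<lambda>_. 1) k"
    by (simp flip: sum_spanning_trees)
  also have "\<dots> = 1 / 2 * ((1 - (2 - sqrt 3)) / (1 + (2 - sqrt 3))) *
      ((1 / (2 - sqrt 3)) ^ n - (2 - sqrt 3) ^ n)"
    by (rule solved[of 1]) simp_all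
  also have "1 / (2 - sqrt 3) = 2 + sqrt 3"
  proof -
    have "(2 - sqrt 3) * (2 + sqrt 3) = 1" by (simp add: algebra_simps)
    then show ?thesis by (metis nonzero_divide_eq_eq mult.commute mult_zero_left zero_neq_one)
  qed
  also have "1 / 2 * ((1 - (2 - sqrt 3)) / (1 + (2 - sqrt 3))) = 1 / (2 * sqrt 3)"
  proof -
    have "sqrt 3 * (sqrt 3 - 1) = 3 - sqrt 3" by (simp add: algebra_simps)
    moreover have "sqrt 3 < 3" by (rule real_less_lsqrt) simp_all
    ultimately show ?thesis by (simp add: field_simps)
  qed
  finally have "real (card (spanning_trees (ladder_segment 0 (int k)))) =
      1 / (2 * sqrt 3) * ((2 + sqrt 3) ^ n - (2 - sqrt 3) ^ n)" .
  moreover note alpha_properties(1,2) solved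
  ultimately show ?thesis
    unfolding seg inverse sum_spanning_trees by simp
qed

end
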